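(* Let $\mathbb{K}$ be an arbitrary field, $A$ an $n\times n$ matrix over $\mathbb{K}$, and for $i=1,\dots,n$ let $p_i(A)=e_{n-i+1}(xE_n-A)$ be the $i$-th invariant polynomial of $A$ (so $p_n(A)\mid p_{n-1}(A)\mid\cdots\mid p_1(A)$). Let $k$ be the number of indices $i$ such that $p_i(A)$ cannot be factored into distinct linear factors over $\mathbb{K}$. Then $\mathrm{rank}_{\mathbb{K}}(E_n;A)\ge n+k$.
   Context: For a square matrix $A(x)$ over $\mathbb{K}[x]$, $d_i(A(x))$ is the (monic) greatest common divisor of the $i\times i$ minors of $A(x)$ ($d_0=1$), and the $i$-th elementary divisor (invariant factor) is $e_i(A(x))=d_i(A(x))/d_{i-1}(A(x))$ when $d_{i-1}\ne0$; thus $e_1(xE_n-A)\mid e_2(xE_n-A)\mid\cdots\mid e_n(xE_n-A)$ and their product is $\det(xE_n-A)$. $E_n$ is the identity; $(E_n;A)$ is the $n\times n\times2$ tensor with slices $E_n$ and $A$. A rank-one tensor over $\mathbb{K}$ has the form $(\alpha\,\mathbf{a}\mathbf{b}^T;\beta\,\mathbf{a}\mathbf{b}^T)$ with nonzero $\mathbf{a},\mathbf{b}\in\mathbb{K}^n$ and $(\alpha,\beta)\ne0$; $\mathrm{rank}_{\mathbb{K}}$ is the minimal number of rank-one tensors over $\mathbb{K}$ summing slicewise to the tensor. *)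

theory Defs
  imports "HOL-Computational_Algebra.Polynomial" "Jordan_Normal_Form.Char_Poly" "Jordan_Normal_Form.DL_Submatrix"
begin

definition poly_Gcd :: "'a::field poly set \<Rightarrow> 'a poly" where
  "poly_Gcd S = (THE d. (\<forall>p\<in>S. d dvd p) \<and> (\<forall>q. (\<forall>p\<in>S. q dvd p) \<longrightarrow> q dvd d)
                      \<and> (d = 0 \<or> lead_coeff d = 1))"

definition minors :: "'a::field poly mat \<Rightarrow> nat \<Rightarrow> 'a poly set" where
  "minors M i = {det (submatrix M I J) | I J.
      I \<subseteq> {..<dim_row M} \<and> J \<subseteq> {..<dim_col M} \<and> card I = i \<and> card J = i}"

definition det_divisor :: "'a::field poly mat \<Rightarrow> nat \<Rightarrow> 'a poly" where
  "det_divisor M i = (if i = 0 then 1 else poly_Gcd (minors M i))"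

definition elem_divisor :: "'a::field poly mat \<Rightarrow> nat \<Rightarrow> 'a poly" where
  "elem_divisor M i = det_divisor M i div det_divisor M (i - 1)"

definition invariant_poly :: "'a::field mat \<Rightarrow> nat \<Rightarrow> 'a poly" where
  "invariant_poly A i = elem_divisor (char_poly_matrix A) (dim_row A - i + 1)"

definition splits_distinct :: "'a::field poly \<Rightarrow> bool" where
  "splits_distinct p \<longleftrightarrow> (\<exists>S. finite S \<and> p = (\<Prod>a\<in>S. [:-a, 1:]))"

(* rank over K of the n x n x 2 tensor (B;C): least number of rank-one tensors
   (alpha a b^T; beta a b^T), a,b nonzero, (alpha,beta) nonzero, summing slicewise *)
definition tensor_rank2 :: "nat \<Rightarrow> 'a::field mat \<Rightarrow> 'a mat \<Rightarrow> nat" where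
  "tensor_rank2 n B C = (LEAST r. \<exists>(a :: nat \<Rightarrow> 'a vec) (b :: nat \<Rightarrow> 'a vec) (\<alpha> :: nat \<Rightarrow> 'a) (\<beta> :: nat \<Rightarrow> 'a).
      (\<forall>j<r. a j \<in> carrier_vec n \<and> b j \<in> carrier_vec n \<and> a j \<noteq> 0\<^sub>v n \<and> b j \<noteq> 0\<^sub>v n
              \<and> (\<alpha> j, \<beta> j) \<noteq> (0, 0)) \<and>
      (\<forall>p<n. \<forall>q<n. B $$ (p, q) = (\<Sum>j<r. \<alpha> j * (a j $ p) * (b j $ q))
                 \<and> C $$ (p, q) = (\<Sum>j<r. \<beta> j * (a j $ p) * (b j $ q))))"

end

theory Submission
  imports Defs
begin

text \<open>A decomposition into \<open>r\<close> rank-one tensors factors the characteristic matrix as \<open>M = P D Q\<close> with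
  constant \<open>P\<close>, \<open>Q\<close> and \<open>D\<close> diagonal with entries \<open>\<alpha>\<^sub>j x - \<beta>\<^sub>j\<close>. Let \<open>f\<close> be the product of the
  distinct linear factors occurring in \<open>D\<close>, so that \<open>D F = f\<close> for a polynomial matrix \<open>F\<close>. If
  \<open>S = U M V\<close> is the Smith form, counting unknowns gives, whenever \<open>s + r < 2 n\<close>, a nonzero row \<open>w\<close>
  vanishing in the first \<open>s\<close> places for which \<open>w U P D\<close> lies in the row span of a left inverse of
  \<open>Q\<close>. This yields \<open>f w = w S X\<close>, where only diagonal entries of \<open>S\<close> from the position \<open>s\<close> on
  contribute. All of them are multiples of \<open>S\<^sub>s\<^sub>s\<close>; taking \<open>w\<close> primitive, \<open>S\<^sub>s\<^sub>s\<close> divides \<open>f\<close> and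
  hence is a product of distinct linear factors. Only the last \<open>r - n\<close> invariant factors escape.\<close>

section \<open>Smith normal form\<close>

definition equiv_mat :: "nat \<Rightarrow> 'a::comm_ring_1 mat \<Rightarrow> 'a mat \<Rightarrow> bool" where
  "equiv_mat n M N \<longleftrightarrow> M \<in> carrier_mat n n \<and> (\<exists>U U' V V'.
     U \<in> carrier_mat n n \<and> U' \<in> carrier_mat n n \<and> V \<in> carrier_mat n n \<and> V' \<in> carrier_mat n n \<and>
     U * U' = 1\<^sub>m n \<and> U' * U = 1\<^sub>m n \<and> V * V' = 1\<^sub>m n \<and> V' * V = 1\<^sub>m n \<and> N = U * M * V)"

lemma equiv_matI:
  assumes "M \<in> carrier_mat n n" "U \<in> carrier_mat n n" "U' \<in> carrier_mat n n"
    "V \<in> carrier_mat n n" "V' \<in> carrier_mat n n"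
    "U * U' = 1\<^sub>m n" "U' * U = 1\<^sub>m n" "V * V' = 1\<^sub>m n" "V' * V = 1\<^sub>m n" "N = U * M * V"
  shows "equiv_mat n M N"
  unfolding equiv_mat_def using assms by blast

lemma equiv_matE:
  assumes "equiv_mat n M N"
  obtains U U' V V' where "M \<in> carrier_mat n n" "N \<in> carrier_mat n n"
    "U \<in> carrier_mat n n" "U' \<in> carrier_mat n n"
    "V \<in> carrier_mat n n" "V' \<in> carrier_mat n n"
    "U * U' = 1\<^sub>m n" "U' * U = 1\<^sub>m n" "V * V' = 1\<^sub>m n" "V' * V = 1\<^sub>m n"
    "N = U * M * V" "M = U' * N * V'"
proof -
  from assms[unfolded equiv_mat_def] obtain U U' V V' where
    c: "M \<in> carrier_mat n n" "U \<in> carrier_mat n n" "U' \<in> carrier_mat n n"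
    "V \<in> carrier_mat n n" "V' \<in> carrier_mat n n" and
    e: "U * U' = 1\<^sub>m n" "U' * U = 1\<^sub>m n" "V * V' = 1\<^sub>m n" "V' * V = 1\<^sub>m n" "N = U * M * V"
    by blast
  have "U' * N * V' = U' * (U * M * V) * V'" by (simp add: e)
  also have "\<dots> = (U' * U) * M * (V * V')"
    using c by (simp add: assoc_mult_mat[of _ n n _ n _ n])
  also have "\<dots> = M" using c by (simp add: e)
  finally have M: "M = U' * N * V'" by simp
  have "N \<in> carrier_mat n n" unfolding e(5) using c by auto
  from that[OF c(1) this c(2-5) e M] show ?thesis .
qed

lemma equiv_mat_carrier:
  "equiv_mat n M N \<Longrightarrow> M \<in> carrier_mat n n" "equiv_mat n M N \<Longrightarrow> N \<in> carrier_mat n n"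
  by (auto elim: equiv_matE)

lemma equiv_mat_refl: "M \<in> carrier_mat n n \<Longrightarrow> equiv_mat n M M"
  by (rule equiv_matI[of _ _ "1\<^sub>m n" "1\<^sub>m n" "1\<^sub>m n" "1\<^sub>m n"]) auto

lemma mult_inverse_mat:
  assumes "A \<in> carrier_mat n n" "A' \<in> carrier_mat n n" "B \<in> carrier_mat n n" "B' \<in> carrier_mat n n"
    and "A * A' = 1\<^sub>m n" "B * B' = 1\<^sub>m n"
  shows "(A * B) * (B' * A') = (1\<^sub>m n :: 'a::comm_ring_1 mat)"
proof -
  have "(A * B) * (B' * A') = A * (B * B') * A'"
    using assms(1-4) by (simp add: assoc_mult_mat[of _ n n _ n _ n])
  then show ?thesis using assms by simp
qed

lemma equiv_mat_trans:
  assumes "equiv_mat n M N" "equiv_mat n N K"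
  shows "equiv_mat n M K"
proof -
  from assms(1) obtain U U' V V' where
    1: "M \<in> carrier_mat n n" "U \<in> carrier_mat n n" "U' \<in> carrier_mat n n"
    "V \<in> carrier_mat n n" "V' \<in> carrier_mat n n"
    "U * U' = 1\<^sub>m n" "U' * U = 1\<^sub>m n" "V * V' = 1\<^sub>m n" "V' * V = 1\<^sub>m n" "N = U * M * V"
    by (rule equiv_matE)
  from assms(2) obtain X X' Y Y' where
    2: "X \<in> carrier_mat n n" "X' \<in> carrier_mat n n" "Y \<in> carrier_mat n n" "Y' \<in> carrier_mat n n"
    "X * X' = 1\<^sub>m n" "X' * X = 1\<^sub>m n" "Y * Y' = 1\<^sub>m n" "Y' * Y = 1\<^sub>m n" "K = X * N * Y"
    by (rule equiv_matE)
  have inv: "(X * U) * (U' * X') = 1\<^sub>m n" "(U' * X') * (X * U) = 1\<^sub>m n"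
    "(V * Y) * (Y' * V') = 1\<^sub>m n" "(Y' * V') * (V * Y) = 1\<^sub>m n"
    by (rule mult_inverse_mat; use 1 2 in blast)+
  have K: "K = (X * U) * M * (V * Y)"
    using 1 2 by (simp add: assoc_mult_mat[of _ n n _ n _ n])
  show ?thesis
    by (rule equiv_matI[OF _ _ _ _ _ inv K])
      (use 1 2 in auto)
qed

text \<open>Transposing exchanges the left and right factors. Column operations can therefore be
  carried out as row operations on the transpose.\<close>

lemma equiv_mat_transpose:
  assumes "equiv_mat n M N"
  shows "equiv_mat n (transpose_mat M) (transpose_mat N)"
proof -
  from assms obtain U U' V V' where
    1: "M \<in> carrier_mat n n" "U \<in> carrier_mat n n" "U' \<in> carrier_mat n n"
    "V \<in> carrier_mat n n" "V' \<in> carrier_mat n n"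
    and 2: "U * U' = 1\<^sub>m n" "U' * U = 1\<^sub>m n" "V * V' = 1\<^sub>m n" "V' * V = 1\<^sub>m n" "N = U * M * V"
    by (rule equiv_matE)
  have inv: "transpose_mat B * transpose_mat A = 1\<^sub>m n" if "A * B = 1\<^sub>m n"
    "A \<in> carrier_mat n n" "B \<in> carrier_mat n n" for A B :: "'a mat"
    using transpose_mult[OF that(2,3)] that(1) by (metis transpose_one)
  have N: "transpose_mat N = transpose_mat V * transpose_mat M * transpose_mat U"
    unfolding 2(5) transpose_mult[OF mult_carrier_mat[OF 1(2,1)] 1(4)] transpose_mult[OF 1(2,1)]
    using 1 by (intro assoc_mult_mat[symmetric, of _ n n _ n _ n]) auto
  show ?thesis
    by (rule equiv_matI[OF _ _ _ _ _ inv[OF 2(4) 1(5,4)] inv[OF 2(3) 1(4,5)]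
          inv[OF 2(2) 1(3,2)] inv[OF 2(1) 1(2,3)] N]) (use 1 in auto)
qed

section \<open>Elementary row operations as equivalences\<close>

lemma equiv_mat_mult_left:
  assumes "M \<in> carrier_mat n n" "U \<in> carrier_mat n n" "U' \<in> carrier_mat n n"
    "U * U' = 1\<^sub>m n" "U' * U = 1\<^sub>m n"
  shows "equiv_mat n M (U * M)"
  by (rule equiv_matI[of _ _ U U' "1\<^sub>m n" "1\<^sub>m n"]) (use assms in auto)

lemma equiv_mat_addrow:
  assumes "M \<in> carrier_mat n n" "k < n" "l < n" "k \<noteq> l"
  shows "equiv_mat n M (addrow a k l M)"
  unfolding addrow_mat[OF assms(1,3)]
  by (rule equiv_mat_mult_left[of _ _ _ "addrow_mat n (-a) k l"])
    (use assms addrow_mat_inv[of k n l a] addrow_mat_inv[of k n l "-a"] in auto)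

lemma equiv_mat_swaprows:
  assumes "M \<in> carrier_mat n n" "k < n" "l < n"
  shows "equiv_mat n M (swaprows k l M)"
  unfolding swaprows_mat[OF assms]
  by (rule equiv_mat_mult_left[of _ _ _ "swaprows_mat n k l"])
    (use assms swaprows_mat_inv[of k n l] in auto)

text \<open>Entries of \<open>U * M * V\<close> are linear combinations of entries of
  \<open>M\<close>. This carries divisibility by the pivot through the reduction of the remaining
  block.\<close>

lemma equiv_mat_dvd_entries:
  assumes "equiv_mat n M N" "\<And>i j. i < n \<Longrightarrow> j < n \<Longrightarrow> g dvd M $$ (i,j)" "i < n" "j < n"
  shows "g dvd N $$ (i,j)"
proof -
  from assms(1) obtain U U' V V' where
    1: "M \<in> carrier_mat n n" "U \<in> carrier_mat n n" "V \<in> carrier_mat n n" "N = U * M * V"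
    by (rule equiv_matE)
  have "g dvd (U * M) $$ (a,b)" if "a < n" "b < n" for a b
    using 1 that assms(2) by (auto simp: scalar_prod_def intro!: dvd_sum dvd_mult)
  moreover have "N $$ (i,j) = (\<Sum>k = 0..<n. (U * M) $$ (i,k) * V $$ (k,j))"
    unfolding 1(4) using 1(1-3) assms(3,4) by (subst index_mult_mat) (auto simp: scalar_prod_def)
  ultimately show ?thesis using assms(3,4) by (auto intro!: dvd_sum dvd_mult2)
qed

text \<open>Multiples of the first row are subtracted from the lower rows. The first row stays
  intact, so a later use on the transpose preserves the zeros already created.\<close>

lemma clear_first_col:
  assumes "M \<in> carrier_mat (Suc n) (Suc n)"
    and "\<And>i. i < Suc n \<Longrightarrow> M $$ (0,0) dvd M $$ (i,0)"
  obtains N where "equiv_mat (Suc n) M N" "\<And>j. j < Suc n \<Longrightarrow> N $$ (0,j) = M $$ (0,j)"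
    "\<And>i. 0 < i \<Longrightarrow> i < Suc n \<Longrightarrow> N $$ (i,0) = 0"
proof -
  \<comment> \<open>Rows up to \<open>k\<close> are cleared, while later rows keep their original
    first entry, so the divisibility hypothesis still applies to them.\<close>
  have "\<exists>N. equiv_mat (Suc n) M N \<and> (\<forall>j<Suc n. N $$ (0,j) = M $$ (0,j)) \<and>
      (\<forall>i<Suc n. 0 < i \<longrightarrow> i \<le> k \<longrightarrow> N $$ (i,0) = 0) \<and> (\<forall>i<Suc n. i > k \<longrightarrow> N $$ (i,0) = M $$ (i,0))" for k
  proof (induction k)
    case 0
    show ?case by (rule exI[of _ M]) (use assms equiv_mat_refl in auto)
  next
    case (Suc k)
    then obtain N where N: "equiv_mat (Suc n) M N" "\<forall>j<Suc n. N $$ (0,j) = M $$ (0,j)"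
      "\<forall>i<Suc n. 0 < i \<longrightarrow> i \<le> k \<longrightarrow> N $$ (i,0) = 0" "\<forall>i<Suc n. i > k \<longrightarrow> N $$ (i,0) = M $$ (i,0)"
      by blast
    have c: "N \<in> carrier_mat (Suc n) (Suc n)" using N(1) by (rule equiv_mat_carrier)
    show ?case
    proof (cases "Suc k < Suc n")
      case False
      with N show ?thesis by (intro exI[of _ N]) auto
    next
      case True
      obtain q where q: "M $$ (Suc k, 0) = M $$ (0,0) * q" using assms(2)[OF True] by (auto elim: dvdE)
      let ?N = "addrow (-q) (Suc k) 0 N"
      have "equiv_mat (Suc n) N ?N" by (rule equiv_mat_addrow[OF c]) (use True in auto)
      then have "equiv_mat (Suc n) M ?N" using N(1) equiv_mat_trans by blast
      moreover have "?N $$ (Suc k, 0) = 0" using c True N(2,4) q by auto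
      ultimately show ?thesis using c N True by (intro exI[of _ ?N]) (auto simp: le_Suc_eq)
    qed
  qed
  from this[of n] obtain N where N: "equiv_mat (Suc n) M N" "\<forall>j<Suc n. N $$ (0,j) = M $$ (0,j)"
      "\<forall>i<Suc n. 0 < i \<longrightarrow> i \<le> n \<longrightarrow> N $$ (i,0) = 0" by blast
  then show ?thesis by (intro that[of N]) auto
qed

text \<open>The transforming matrices are bordered by a 1 in the corner. This lifts the Smith form
  of the remaining block to the whole matrix.\<close>

lemma equiv_mat_four_block:
  assumes "equiv_mat n M N"
  shows "equiv_mat (Suc n) (four_block_mat (mat 1 1 (\<lambda>_. a)) (0\<^sub>m 1 n) (0\<^sub>m n 1) M)
    (four_block_mat (mat 1 1 (\<lambda>_. a)) (0\<^sub>m 1 n) (0\<^sub>m n 1) N)"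
proof -
  from assms obtain U U' V V' where
    1: "M \<in> carrier_mat n n" "U \<in> carrier_mat n n" "U' \<in> carrier_mat n n"
    "V \<in> carrier_mat n n" "V' \<in> carrier_mat n n" and
    2: "U * U' = 1\<^sub>m n" "U' * U = 1\<^sub>m n" "V * V' = 1\<^sub>m n" "V' * V = 1\<^sub>m n" "N = U * M * V"
    by (rule equiv_matE)
  let ?B = "\<lambda>c X. four_block_mat c (0\<^sub>m 1 n) (0\<^sub>m n 1) (X :: 'a mat)"
  have mult: "?B c X * ?B d Y = ?B (c * d) (X * Y)"
    if "X \<in> carrier_mat n n" "Y \<in> carrier_mat n n" "c \<in> carrier_mat 1 1" "d \<in> carrier_mat 1 1" for c d X Y
    using that by (subst mult_four_block_mat[of _ 1 1 _ n _ n _ _ 1 _ n]) auto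
  have car: "?B c X \<in> carrier_mat (Suc n) (Suc n)" if "X \<in> carrier_mat n n" "c \<in> carrier_mat 1 1" for c X
    using four_block_carrier_mat[OF that(2,1)] by simp
  have one: "?B (1\<^sub>m 1) (1\<^sub>m n) = 1\<^sub>m (Suc n)"
    by (subst four_block_one_mat) auto
  have inv: "?B (1\<^sub>m 1) X * ?B (1\<^sub>m 1) Y = 1\<^sub>m (Suc n)"
    if "X \<in> carrier_mat n n" "Y \<in> carrier_mat n n" "X * Y = 1\<^sub>m n" for X Y
    unfolding mult[OF that(1,2) one_carrier_mat one_carrier_mat] that(3)
      left_mult_one_mat[OF one_carrier_mat] by (rule one)
  have N: "?B (mat 1 1 (\<lambda>_. a)) N =
      ?B (1\<^sub>m 1) U * ?B (mat 1 1 (\<lambda>_. a)) M * ?B (1\<^sub>m 1) V"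
    unfolding 2(5) mult[OF 1(2,1) one_carrier_mat mat_carrier]
      left_mult_one_mat[OF mat_carrier] mult[OF mult_carrier_mat[OF 1(2,1)] 1(4) mat_carrier one_carrier_mat]
      right_mult_one_mat[OF mat_carrier] ..
  show ?thesis
    by (rule equiv_matI[OF _ _ _ _ _ inv[OF 1(2,3) 2(1)] inv[OF 1(3,2) 2(2)] inv[OF 1(4,5) 2(3)]
          inv[OF 1(5,4) 2(4)] N]; intro car 1 one_carrier_mat mat_carrier)
qed

text \<open>An entry of minimal degree in the corner, over all matrices equivalent to the given one,
  divides every entry of its row and column, since otherwise division with remainder followed by a
  row operation and a swap would lower the degree.\<close>
lemma min_degree_dvd_col:
  fixes N :: "'a::field poly mat"
  assumes "N \<in> carrier_mat n n" "0 < n" "N $$ (0,0) \<noteq> 0"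
    and min: "\<And>K. equiv_mat n N K \<Longrightarrow> K $$ (0,0) \<noteq> 0 \<Longrightarrow> degree (N $$ (0,0)) \<le> degree (K $$ (0,0))"
    and i: "i < n"
  shows "N $$ (0,0) dvd N $$ (i,0)"
proof (rule ccontr)
  assume nd: "\<not> ?thesis"
  then have i0: "i \<noteq> 0" by (cases i) auto
  let ?q = "N $$ (i,0) div N $$ (0,0)"
  let ?K = "swaprows 0 i (addrow (- ?q) i 0 N)"
  have 1: "equiv_mat n N (addrow (- ?q) i 0 N)" by (rule equiv_mat_addrow) (use assms(1-3) i i0 in auto)
  have "equiv_mat n (addrow (- ?q) i 0 N) ?K"
    by (rule equiv_mat_swaprows) (use assms(1-3) i in auto)
  with 1 have eq: "equiv_mat n N ?K" by (rule equiv_mat_trans)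
  have k: "?K $$ (0,0) = N $$ (i,0) mod N $$ (0,0)"
    using assms(1-3) i i0 by (auto simp: minus_div_mult_eq_mod[symmetric])
  have "N $$ (i,0) mod N $$ (0,0) \<noteq> 0" using nd by (simp add: dvd_eq_mod_eq_0)
  with min[OF eq] degree_mod_less[OF assms(3), of "N $$ (i,0)"] show False unfolding k by auto
qed

lemma min_degree_dvd_row:
  fixes N :: "'a::field poly mat"
  assumes "N \<in> carrier_mat n n" "0 < n" "N $$ (0,0) \<noteq> 0"
    and min: "\<And>K. equiv_mat n N K \<Longrightarrow> K $$ (0,0) \<noteq> 0 \<Longrightarrow> degree (N $$ (0,0)) \<le> degree (K $$ (0,0))"
    and j: "j < n"
  shows "N $$ (0,0) dvd N $$ (0,j)"
proof -
  have "transpose_mat N $$ (0,0) dvd transpose_mat N $$ (j,0)"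
  proof (rule min_degree_dvd_col)
    fix K assume K: "equiv_mat n (transpose_mat N) K" "K $$ (0,0) \<noteq> 0"
    have "equiv_mat n N (transpose_mat K)" using equiv_mat_transpose[OF K(1)] by simp
    from min[OF this] K(2) equiv_mat_carrier[OF K(1)] assms(1-3)
    show "degree (transpose_mat N $$ (0,0)) \<le> degree (K $$ (0,0))" by auto
  qed (use assms(1-3) j in auto)
  then show ?thesis using assms(1-3) j by auto
qed

text \<open>A nonzero corner of least degree in the equivalence class divides its row and column,
  which can then be cleared. Adding a lower row to the first one shows that it divides the remaining
  block too.\<close>

lemma smith_pivot:
  fixes M :: "'a::field poly mat"
  assumes M: "M \<in> carrier_mat (Suc n) (Suc n)" and nz: "M \<noteq> 0\<^sub>m (Suc n) (Suc n)"
  obtains a B where "B \<in> carrier_mat n n" "\<And>i j. i < n \<Longrightarrow> j < n \<Longrightarrow> a dvd B $$ (i,j)"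
    "equiv_mat (Suc n) M (four_block_mat (mat 1 1 (\<lambda>_. a)) (0\<^sub>m 1 n) (0\<^sub>m n 1) B)"
proof -
  let ?N = "Suc n"
  let ?P = "\<lambda>N. equiv_mat ?N M N \<and> N $$ (0,0) \<noteq> 0"
  \<comment> \<open>A row swap and a column swap, the latter through the transpose, bring any
    nonzero entry to the corner.\<close>
  have "\<exists>N. ?P N"
  proof -
    obtain i j where ij: "i < ?N" "j < ?N" "M $$ (i,j) \<noteq> 0"
    proof -
      have "\<exists>i<?N. \<exists>j<?N. M $$ (i,j) \<noteq> 0"
      proof (rule ccontr)
        assume "\<not> ?thesis"
        then have "M = 0\<^sub>m ?N ?N" using M by (intro eq_matI) auto
        with nz show False by simp
      qed
      then show ?thesis using that by blast
    qed
    let ?K = "swaprows 0 i M"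
    let ?L = "transpose_mat (swaprows 0 j (transpose_mat ?K))"
    have K: "equiv_mat ?N M ?K" by (rule equiv_mat_swaprows) (use M ij in auto)
    have "equiv_mat ?N (transpose_mat ?K) (swaprows 0 j (transpose_mat ?K))"
      by (rule equiv_mat_swaprows) (use M ij in auto)
    from equiv_mat_transpose[OF this] have "equiv_mat ?N ?K ?L" by simp
    with K have "equiv_mat ?N M ?L" by (rule equiv_mat_trans)
    moreover have "?L $$ (0,0) = M $$ (i,j)" using M ij by auto
    ultimately show ?thesis using ij by metis
  qed
  then obtain N where N: "?P N" and "\<And>K. ?P K \<Longrightarrow> degree (N $$ (0,0)) \<le> degree (K $$ (0,0))"
    using ex_has_least_nat[of ?P _ "\<lambda>N. degree (N $$ (0,0))"] by blast
  note min = this(2)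
  define d where "d = degree (N $$ (0,0))"
  \<comment> \<open>Minimality refers to the whole class of \<open>M\<close>, so the divisibility
    holds for every equivalent matrix whose corner has the same degree and can be reused after each
    modification.\<close>
  have dvd: "K $$ (0,0) dvd K $$ (i,0)" "K $$ (0,0) dvd K $$ (0,i)"
    if "?P K" "degree (K $$ (0,0)) = d" "i < ?N" for K i
  proof -
    have c: "K \<in> carrier_mat ?N ?N" using that(1) equiv_mat_carrier by blast
    have m: "degree (K $$ (0,0)) \<le> degree (L $$ (0,0))" if "equiv_mat ?N K L" "L $$ (0,0) \<noteq> 0" for L
      using min[of L] that \<open>?P K\<close> \<open>degree (K $$ (0,0)) = d\<close> equiv_mat_trans unfolding d_def by metis
    show "K $$ (0,0) dvd K $$ (i,0)" "K $$ (0,0) dvd K $$ (0,i)"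
      using min_degree_dvd_col[OF c _ _ m that(3)] min_degree_dvd_row[OF c _ _ m that(3)] that(1) by auto
  qed
  have c: "N \<in> carrier_mat ?N ?N" using N equiv_mat_carrier by blast
  obtain N1 where N1: "equiv_mat ?N N N1" "\<And>j. j < ?N \<Longrightarrow> N1 $$ (0,j) = N $$ (0,j)"
    "\<And>i. 0 < i \<Longrightarrow> i < ?N \<Longrightarrow> N1 $$ (i,0) = 0"
    using clear_first_col[OF c] dvd[OF N d_def[symmetric]] by metis
  have c1: "N1 \<in> carrier_mat ?N ?N" using N1 equiv_mat_carrier by blast
  have P1: "?P N1" using N N1 equiv_mat_trans by (metis zero_less_Suc)
  have d1: "degree (N1 $$ (0,0)) = d" using N1 d_def by simp
  obtain N2 where N2: "equiv_mat ?N (transpose_mat N1) N2"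
    "\<And>j. j < ?N \<Longrightarrow> N2 $$ (0,j) = transpose_mat N1 $$ (0,j)"
    "\<And>i. 0 < i \<Longrightarrow> i < ?N \<Longrightarrow> N2 $$ (i,0) = 0"
  proof (rule clear_first_col[of "transpose_mat N1" n])
    show "transpose_mat N1 $$ (0,0) dvd transpose_mat N1 $$ (i,0)" if "i < ?N" for i
      using dvd(2)[OF P1 d1 that] c1 that by auto
  qed (use c1 in auto)
  have c2: "N2 \<in> carrier_mat ?N ?N" using N2 equiv_mat_carrier by blast
  let ?K = "transpose_mat N2"
  have "equiv_mat ?N N1 ?K" using equiv_mat_transpose[OF N2(1)] by simp
  then have MK: "equiv_mat ?N M ?K" using P1 equiv_mat_trans by blast
  have K0: "?K $$ (0,0) = N1 $$ (0,0)" using N2(2)[of 0] c1 c2 by auto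
  have Kr: "?K $$ (0,j) = 0" if "0 < j" "j < ?N" for j using N2(3)[OF that] c2 that by auto
  have Kc: "?K $$ (i,0) = 0" if "0 < i" "i < ?N" for i using N2(2) N1(3)[OF that] c1 c2 that by auto
  let ?a = "?K $$ (0,0)"
  define B where "B = mat n n (\<lambda>(i,j). ?K $$ (Suc i, Suc j))"
  have B: "B \<in> carrier_mat n n" by (simp add: B_def)
  have Keq: "?K = four_block_mat (mat 1 1 (\<lambda>_. ?a)) (0\<^sub>m 1 n) (0\<^sub>m n 1) B"
    by (rule eq_matI) (use c2 Kr Kc in \<open>auto simp: B_def\<close>)
  have "?a dvd B $$ (i,j)" if ij: "i < n" "j < n" for i j
  proof -
    \<comment> \<open>The first column is zero below the corner, so this operation keeps the corner
      and copies a row of \<open>B\<close> into the first row.\<close>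
    let ?L = "addrow 1 0 (Suc i) ?K"
    have "equiv_mat ?N ?K ?L" by (rule equiv_mat_addrow) (use c2 ij in auto)
    then have "equiv_mat ?N M ?L" using MK equiv_mat_trans by blast
    moreover have L0: "?L $$ (0,0) = ?a" using c2 Kc[of "Suc i"] ij by auto
    ultimately have "?L $$ (0,0) dvd ?L $$ (0, Suc j)" using dvd(2)[of ?L "Suc j"] P1 d1 K0 ij by auto
    moreover have "?L $$ (0, Suc j) = B $$ (i,j)" using c2 Kr[of "Suc j"] ij by (auto simp: B_def)
    ultimately show ?thesis using L0 by simp
  qed
  then show ?thesis using that[OF B] MK Keq by metis
qed

text \<open>Induction on the size: the pivot divides every entry of the block, hence every entry of
  the Smith form of the block, which extends the divisibility chain.\<close>

theorem smith_form_exists: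
  fixes M :: "'a::field poly mat"
  assumes "M \<in> carrier_mat n n"
  shows "\<exists>S. equiv_mat n M S \<and> (\<forall>i<n. \<forall>j<n. i \<noteq> j \<longrightarrow> S $$ (i,j) = 0) \<and>
    (\<forall>j<n. \<forall>i\<le>j. S $$ (i,i) dvd S $$ (j,j))"
  using assms
proof (induction n arbitrary: M)
  case 0
  then show ?case using equiv_mat_refl by blast
next
  case (Suc n)
  show ?case
  proof (cases "M = 0\<^sub>m (Suc n) (Suc n)")
    case True
    then show ?thesis using equiv_mat_refl[OF Suc.prems] by (intro exI[of _ M]) auto
  next
    case False
    from smith_pivot[OF Suc.prems False] obtain a B where B: "B \<in> carrier_mat n n"
      "\<And>i j. i < n \<Longrightarrow> j < n \<Longrightarrow> a dvd B $$ (i,j)"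
      "equiv_mat (Suc n) M (four_block_mat (mat 1 1 (\<lambda>_. a)) (0\<^sub>m 1 n) (0\<^sub>m n 1) B)"
      by metis
    from Suc.IH[OF B(1)] obtain S where S: "equiv_mat n B S"
      "\<forall>i<n. \<forall>j<n. i \<noteq> j \<longrightarrow> S $$ (i,j) = 0" "\<forall>j<n. \<forall>i\<le>j. S $$ (i,i) dvd S $$ (j,j)" by blast
    have c: "S \<in> carrier_mat n n" using S(1) equiv_mat_carrier by blast
    have aS: "a dvd S $$ (i,j)" if "i < n" "j < n" for i j
      using equiv_mat_dvd_entries[OF S(1) B(2) that] .
    let ?S = "four_block_mat (mat 1 1 (\<lambda>_. a)) (0\<^sub>m 1 n) (0\<^sub>m n 1) S"
    have "equiv_mat (Suc n) M ?S" using B(3) equiv_mat_four_block[OF S(1)] equiv_mat_trans by blast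
    moreover have "\<forall>i<Suc n. \<forall>j<Suc n. i \<noteq> j \<longrightarrow> ?S $$ (i,j) = 0" using c S(2) by auto
    moreover have "\<forall>j<Suc n. \<forall>i\<le>j. ?S $$ (i,i) dvd ?S $$ (j,j)" using c S(3) aS by auto
    ultimately show ?thesis by blast
  qed
qed

section \<open>Determinantal divisors\<close>

text \<open>Rows and columns are selected by arbitrary functions, so that multilinear expansion of a matrix
  product stays within the family; repeated rows or columns only add zero minors.\<close>
definition dvd_minors :: "'a::comm_ring_1 \<Rightarrow> nat \<Rightarrow> nat \<Rightarrow> 'a mat \<Rightarrow> bool" where
  "dvd_minors g n i M \<longleftrightarrow> (\<forall>\<phi> \<psi>. (\<forall>a<i. \<phi> a < n) \<longrightarrow> (\<forall>b<i. \<psi> b < n) \<longrightarrow>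
     g dvd det (mat i i (\<lambda>(a,b). M $$ (\<phi> a, \<psi> b))))"

lemma dvd_minorsD:
  assumes "dvd_minors g n i M" "\<And>a. a < i \<Longrightarrow> \<phi> a < n" "\<And>b. b < i \<Longrightarrow> \<psi> b < n"
  shows "g dvd det (mat i i (\<lambda>(a,b). M $$ (\<phi> a, \<psi> b)))"
  using assms unfolding dvd_minors_def by blast

lemma det_mat_transpose:
  fixes f :: "nat \<Rightarrow> nat \<Rightarrow> 'a::comm_ring_1"
  shows "det (mat i i (\<lambda>(a,b). f a b)) = det (mat i i (\<lambda>(a,b). f b a))"
proof -
  have "mat i i (\<lambda>(a,b). f b a) = transpose_mat (mat i i (\<lambda>(a,b). f a b))"
    by (rule eq_matI) auto
  then show ?thesis using det_transpose[of "mat i i (\<lambda>(a,b). f a b)" i] by simp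
qed

lemma dvd_minors_transpose:
  assumes "dvd_minors g n i M" "M \<in> carrier_mat n n"
  shows "dvd_minors g n i (transpose_mat M)"
  unfolding dvd_minors_def
proof (intro allI impI)
  fix \<phi> \<psi> :: "nat \<Rightarrow> nat"
  assume *: "\<forall>a<i. \<phi> a < n" "\<forall>b<i. \<psi> b < n"
  have "mat i i (\<lambda>(a,b). transpose_mat M $$ (\<phi> a, \<psi> b)) = mat i i (\<lambda>(a,b). M $$ (\<psi> b, \<phi> a))"
    by (rule eq_matI) (use * assms(2) in auto)
  with assms(1) * show "g dvd det (mat i i (\<lambda>(a,b). transpose_mat M $$ (\<phi> a, \<psi> b)))"
    unfolding dvd_minors_def by (metis det_mat_transpose[of i "\<lambda>a b. M $$ (\<psi> b, \<phi> a)"])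
qed

text \<open>A weak form of Cauchy-Binet: each row of the product is a combination of rows of
  \<open>M\<close>, and multilinearity expands the determinant into determinants built from rows of
  \<open>M\<close>.\<close>

lemma dvd_minors_mult_left:
  assumes "dvd_minors g n i M" "A \<in> carrier_mat n n" "M \<in> carrier_mat n n"
  shows "dvd_minors g n i (A * M)"
  unfolding dvd_minors_def
proof (intro allI impI)
  fix \<phi> \<psi> :: "nat \<Rightarrow> nat"
  assume \<phi>: "\<forall>a<i. \<phi> a < n" and \<psi>: "\<forall>b<i. \<psi> b < n"
  let ?v = "\<lambda>k. vec i (\<lambda>b. M $$ (k, \<psi> b))"
  \<comment> \<open>These are the choices of one row of \<open>M\<close> per row of the minor, made
    unique by the identity outside the index range.\<close>
  let ?F = "{f. (\<forall>a\<in>{0..<i}. f a \<in> {0..<n}) \<and> (\<forall>a. a \<notin> {0..<i} \<longrightarrow> f a = a)}"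
  have entry: "finsum_vec TYPE('a) i (\<lambda>k. A $$ (\<phi> a, k) \<cdot>\<^sub>v ?v k) {0..<n} $ b = (A * M) $$ (\<phi> a, \<psi> b)"
    if "a < i" "b < i" for a b
    using that \<phi> \<psi> assms(2,3) by (subst index_finsum_vec) (auto simp: scalar_prod_def)
  have "mat i i (\<lambda>(a,b). (A * M) $$ (\<phi> a, \<psi> b)) =
      mat\<^sub>r i i (\<lambda>a. finsum_vec TYPE('a) i (\<lambda>k. A $$ (\<phi> a, k) \<cdot>\<^sub>v ?v k) {0..<n})"
    by (rule eq_matI) (simp_all add: entry del: index_mult_mat)
  then have "det (mat i i (\<lambda>(a,b). (A * M) $$ (\<phi> a, \<psi> b))) =
      det (mat\<^sub>r i i (\<lambda>a. finsum_vec TYPE('a) i (\<lambda>k. A $$ (\<phi> a, k) \<cdot>\<^sub>v ?v k) {0..<n}))"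
    by (rule arg_cong)
  also have "\<dots> = (\<Sum>f\<in>?F. det (mat\<^sub>r i i (\<lambda>a. A $$ (\<phi> a, f a) \<cdot>\<^sub>v ?v (f a))))"
    by (rule det_linear_rows_sum) simp_all
  also have "\<dots> = (\<Sum>f\<in>?F. (\<Prod>a\<in>{0..<i}. A $$ (\<phi> a, f a)) * det (mat\<^sub>r i i (\<lambda>a. ?v (f a))))"
    by (rule sum.cong[OF refl], rule det_rows_mul) simp
  finally have eq: "det (mat i i (\<lambda>(a,b). (A * M) $$ (\<phi> a, \<psi> b))) = \<dots>" .
  have "g dvd det (mat\<^sub>r i i (\<lambda>a. ?v (f a)))" if "f \<in> ?F" for f
  proof -
    have "mat\<^sub>r i i (\<lambda>a. ?v (f a)) = mat i i (\<lambda>(a,b). M $$ (f a, \<psi> b))" by (rule eq_matI) auto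
    then show ?thesis using assms(1) that \<psi> unfolding dvd_minors_def by auto
  qed
  then show "g dvd det (mat i i (\<lambda>(a,b). (A * M) $$ (\<phi> a, \<psi> b)))"
    unfolding eq by (intro dvd_sum dvd_mult)
qed

lemma dvd_minors_mult_right:
  assumes "dvd_minors g n i M" "A \<in> carrier_mat n n" "M \<in> carrier_mat n n"
  shows "dvd_minors g n i (M * A)"
proof -
  have "dvd_minors g n i (transpose_mat A * transpose_mat M)"
    by (rule dvd_minors_mult_left[OF dvd_minors_transpose[OF assms(1,3)]]) (use assms in auto)
  from dvd_minors_transpose[OF this] show ?thesis
    using assms transpose_mult[OF assms(3,2)] by (metis mult_carrier_mat transpose_carrier_mat transpose_transpose)
qed

text \<open>Since equivalence is symmetric, equivalent matrices have the same common divisors of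
  their minors of each size.\<close>

lemma dvd_minors_equiv_mat:
  assumes "equiv_mat n M N" "dvd_minors g n i M"
  shows "dvd_minors g n i N"
proof -
  from assms(1) obtain U V where
    1: "M \<in> carrier_mat n n" "U \<in> carrier_mat n n" "V \<in> carrier_mat n n" "N = U * M * V"
    by (rule equiv_matE)
  show ?thesis unfolding 1(4)
    by (rule dvd_minors_mult_right[OF dvd_minors_mult_left[OF assms(2) 1(2,1)] 1(3) mult_carrier_mat[OF 1(2,1)]])
qed

lemma equiv_mat_sym:
  assumes "equiv_mat n M N"
  shows "equiv_mat n N M"
  using assms by (rule equiv_matE) (rule equiv_matI)

section \<open>From arbitrary row and column selections to genuine minors\<close>

lemma det_rows_not_inj:
  fixes f :: "nat \<Rightarrow> nat \<Rightarrow> 'a::comm_ring_1"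
  assumes "\<not> inj_on \<phi> {..<i}"
  shows "det (mat i i (\<lambda>(a,b). f (\<phi> a) b)) = 0"
proof -
  from assms obtain a b where ab: "a < i" "b < i" "a \<noteq> b" "\<phi> a = \<phi> b" by (auto simp: inj_on_def)
  show ?thesis
    by (rule det_identical_rows[of _ i a b]) (use ab in \<open>auto intro!: eq_vecI\<close>)
qed

text \<open>The permutation sends \<open>a\<close> to the rank of \<open>\<phi> a\<close> within the
  image, that is, the number of smaller elements; \<open>pick\<close> enumerates the image
  increasingly.\<close>

lemma inj_eq_pick_permutes:
  fixes \<phi> :: "nat \<Rightarrow> nat"
  assumes inj: "inj_on \<phi> {..<i}"
  obtains \<sigma> where "\<sigma> permutes {0..<i}" "\<And>a. a < i \<Longrightarrow> \<phi> a = pick (\<phi> ` {..<i}) (\<sigma> a)"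
proof -
  let ?I = "\<phi> ` {..<i}"
  define \<sigma> where "\<sigma> = (\<lambda>a. if a < i then card {x\<in>?I. x < \<phi> a} else a)"
  have pick: "\<phi> a = pick ?I (\<sigma> a)" if "a < i" for a
    using pick_card_in_set[of "\<phi> a" ?I] that by (simp add: \<sigma>_def)
  have "inj_on \<sigma> {0..<i}"
  proof (rule inj_onI)
    fix a b assume "a \<in> {0..<i}" "b \<in> {0..<i}" "\<sigma> a = \<sigma> b"
    then have "\<phi> a = \<phi> b" using pick[of a] pick[of b] by simp
    then show "a = b" using inj \<open>a \<in> _\<close> \<open>b \<in> _\<close> by (auto dest: inj_onD)
  qed
  moreover have "\<sigma> ` {0..<i} \<subseteq> {0..<i}"
  proof safe
    fix a assume a: "a \<in> {0..<i}"
    have "card {x\<in>?I. x < \<phi> a} < card ?I" by (rule psubset_card_mono) (use a in auto)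
    then show "\<sigma> a \<in> {0..<i}" using a card_image[OF inj] by (simp add: \<sigma>_def)
  qed
  ultimately have "\<sigma> ` {0..<i} = {0..<i}" by (intro endo_inj_surj) auto
  then have "\<sigma> permutes {0..<i}"
    using \<open>inj_on \<sigma> {0..<i}\<close> by (intro bij_imp_permutes) (auto simp: bij_betw_def \<sigma>_def)
  then show ?thesis using pick that by blast
qed

lemma det_rows_pick:
  fixes f :: "nat \<Rightarrow> nat \<Rightarrow> 'a::comm_ring_1"
  assumes "inj_on \<phi> {..<i}"
    and "g dvd det (mat i i (\<lambda>(a,b). f (pick (\<phi> ` {..<i}) a) b))"
  shows "g dvd det (mat i i (\<lambda>(a,b). f (\<phi> a) b))"
proof -
  obtain \<sigma> where \<sigma>: "\<sigma> permutes {0..<i}" "\<And>a. a < i \<Longrightarrow> \<phi> a = pick (\<phi> ` {..<i}) (\<sigma> a)"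
    using inj_eq_pick_permutes[OF assms(1)] by blast
  let ?A = "mat i i (\<lambda>(a,b). f (pick (\<phi> ` {..<i}) a) b)"
  have "\<sigma> a < i" if "a < i" for a using permutes_in_image[OF \<sigma>(1), of a] that by simp
  then have "mat i i (\<lambda>(a,b). f (\<phi> a) b) = mat i i (\<lambda>(a,b). ?A $$ (\<sigma> a, b))"
    by (intro eq_matI) (auto simp: \<sigma>(2))
  also have "det \<dots> = signof \<sigma> * det ?A" by (rule det_permute_rows[OF _ \<sigma>(1)]) auto
  finally show ?thesis using assms(2) by simp
qed

text \<open>Selections with repetitions have determinant zero, and injective ones agree with a minor
  up to the order of rows and columns, hence up to sign.\<close>

lemma dvd_minors_iff:
  assumes M: "M \<in> carrier_mat n n"
  shows "dvd_minors g n i M \<longleftrightarrow> (\<forall>p \<in> minors M i. g dvd p)"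
proof
  have sub: "submatrix M I J = mat i i (\<lambda>(a,b). M $$ (pick I a, pick J b))"
    if "I \<subseteq> {..<n}" "J \<subseteq> {..<n}" "card I = i" "card J = i" for I J
  proof -
    have "{x. x < n \<and> x \<in> I} = I" "{x. x < n \<and> x \<in> J} = J" using that by auto
    then show ?thesis using M that by (simp add: submatrix_def)
  qed
  {
    assume g: "dvd_minors g n i M"
    show "\<forall>p \<in> minors M i. g dvd p"
    proof
      fix p assume "p \<in> minors M i"
      then obtain I J where IJ: "I \<subseteq> {..<n}" "J \<subseteq> {..<n}" "card I = i" "card J = i"
        and p: "p = det (submatrix M I J)" using M by (auto simp: minors_def)
      have "pick K a < n" if "K \<subseteq> {..<n}" "card K = i" "a < i" for K a
      proof -
        have "{x. x < n \<and> x \<in> K} = K" using that by auto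
        then show ?thesis using pick_le[of a n K] that by simp
      qed
      then show "g dvd p" using g IJ unfolding p sub[OF IJ] dvd_minors_def by blast
    qed
  }
  assume g: "\<forall>p \<in> minors M i. g dvd p"
  show "dvd_minors g n i M"
    unfolding dvd_minors_def
  proof (intro allI impI)
    fix \<phi> \<psi> :: "nat \<Rightarrow> nat"
    assume \<phi>: "\<forall>a<i. \<phi> a < n" and \<psi>: "\<forall>b<i. \<psi> b < n"
    show "g dvd det (mat i i (\<lambda>(a,b). M $$ (\<phi> a, \<psi> b)))"
    proof (cases "inj_on \<phi> {..<i} \<and> inj_on \<psi> {..<i}")
      case False
      then show ?thesis
        using det_rows_not_inj[of \<phi> i "\<lambda>x b. M $$ (x, \<psi> b)"] det_rows_not_inj[of \<psi> i "\<lambda>x a. M $$ (\<phi> a, x)"]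
          det_mat_transpose[of i "\<lambda>a b. M $$ (\<phi> a, \<psi> b)"] by auto
    next
      case True
      let ?I = "\<phi> ` {..<i}" and ?J = "\<psi> ` {..<i}"
      have IJ: "?I \<subseteq> {..<n}" "?J \<subseteq> {..<n}" "card ?I = i" "card ?J = i"
        using \<phi> \<psi> True by (auto simp: card_image)
      then have "det (submatrix M ?I ?J) \<in> minors M i" unfolding minors_def using M by blast
      with g have "g dvd det (mat i i (\<lambda>(a,b). M $$ (pick ?I a, pick ?J b)))"
        unfolding sub[OF IJ] by blast
      \<comment> \<open>Columns are reordered as rows of the transpose.\<close>
      then have "g dvd det (mat i i (\<lambda>(b,a). M $$ (pick ?I a, pick ?J b)))"
        by (simp add: det_mat_transpose[of i "\<lambda>a b. M $$ (pick ?I a, pick ?J b)"])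
      then have "g dvd det (mat i i (\<lambda>(b,a). M $$ (pick ?I a, \<psi> b)))"
        using det_rows_pick[of \<psi> i g "\<lambda>x a. M $$ (pick ?I a, x)"] True by simp
      then have "g dvd det (mat i i (\<lambda>(a,b). M $$ (pick ?I a, \<psi> b)))"
        by (simp add: det_mat_transpose[of i "\<lambda>a b. M $$ (pick ?I a, \<psi> b)"])
      then show ?thesis using det_rows_pick[of \<phi> i g "\<lambda>x b. M $$ (x, \<psi> b)"] True by simp
    qed
  qed
qed

text \<open>The maximum of \<open>I\<close> is at least \<open>card I - 1\<close>, so its factor
  absorbs the last factor of the initial product; the rest follows by induction.\<close>

lemma prod_initial_dvd_prod:
  fixes s :: "nat \<Rightarrow> 'a::comm_semiring_1"
  assumes "\<And>j k. j < n \<Longrightarrow> k \<le> j \<Longrightarrow> s k dvd s j" "I \<subseteq> {..<n}"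
  shows "(\<Prod>k<card I. s k) dvd (\<Prod>k\<in>I. s k)"
  using assms(2)
proof (induction "card I" arbitrary: I)
  case (Suc i)
  have fin: "finite I" using Suc.prems finite_subset by blast
  have "I \<noteq> {}" using Suc.hyps(2) by auto
  let ?m = "Max I"
  have m: "?m \<in> I" using fin \<open>I \<noteq> {}\<close> by simp
  have "I \<subseteq> {..?m}" using fin by auto
  from card_mono[OF _ this] have "i \<le> ?m" using Suc.hyps(2) by simp
  then have d: "s i dvd s ?m" using assms(1) m Suc.prems by blast
  have c: "card (I - {?m}) = i" using m Suc.hyps(2) fin by simp
  have "(\<Prod>k<i. s k) dvd (\<Prod>k\<in>I - {?m}. s k)"
    using Suc.hyps(1)[of "I - {?m}"] c Suc.prems by auto
  then have "(\<Prod>k<i. s k) * s i dvd (\<Prod>k\<in>I - {?m}. s k) * s ?m" using d by (rule mult_dvd_mono)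
  then show ?case using prod.remove[OF fin m, of s] Suc.hyps(2)[symmetric] by (simp add: mult.commute)
qed simp

text \<open>In the Leibniz expansion a term can be nonzero only if it uses diagonal entries alone.
  It is then a product of \<open>i\<close> distinct diagonal entries, to which the previous lemma
  applies.\<close>

lemma dvd_minors_smith:
  fixes S :: "'a::comm_ring_1 mat"
  assumes S: "S \<in> carrier_mat n n" and diag: "\<forall>i<n. \<forall>j<n. i \<noteq> j \<longrightarrow> S $$ (i,j) = 0"
    and chain: "\<forall>j<n. \<forall>i\<le>j. S $$ (i,i) dvd S $$ (j,j)"
  shows "dvd_minors (\<Prod>k<i. S $$ (k,k)) n i S"
  unfolding dvd_minors_def
proof (intro allI impI)
  fix \<phi> \<psi> :: "nat \<Rightarrow> nat"
  assume \<phi>: "\<forall>a<i. \<phi> a < n" and \<psi>: "\<forall>b<i. \<psi> b < n"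
  let ?A = "mat i i (\<lambda>(a,b). S $$ (\<phi> a, \<psi> b))" and ?d = "\<Prod>k<i. S $$ (k,k)"
  show "?d dvd det ?A"
  proof (cases "inj_on \<phi> {..<i}")
    case False
    then show ?thesis using det_rows_not_inj[of \<phi> i "\<lambda>x b. S $$ (x, \<psi> b)"] by simp
  next
    case True
    have "?d dvd (\<Prod>a\<in>{0..<i}. ?A $$ (a, p a))" if p: "p permutes {0..<i}" for p
    proof (cases "\<forall>a<i. \<phi> a = \<psi> (p a)")
      case eq: True
      have pl: "p a < i" if "a < i" for a using permutes_in_image[OF p, of a] that by simp
      have "(\<Prod>a\<in>{0..<i}. ?A $$ (a, p a)) = (\<Prod>a\<in>{..<i}. S $$ (\<phi> a, \<phi> a))"
        using pl eq by (intro prod.cong) auto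
      also have "\<dots> = (\<Prod>x\<in>\<phi> ` {..<i}. S $$ (x, x))" using True by (simp add: prod.reindex)
      finally show ?thesis
        using prod_initial_dvd_prod[of n "\<lambda>k. S $$ (k,k)" "\<phi> ` {..<i}"] chain \<phi> card_image[OF True]
        by auto
    next
      case False
      then obtain a where a: "a < i" "\<phi> a \<noteq> \<psi> (p a)" by blast
      then have "p a < i" using permutes_in_image[OF p, of a] by simp
      then have "?A $$ (a, p a) = 0" using a \<phi> \<psi> diag by auto
      then have "(\<Prod>a\<in>{0..<i}. ?A $$ (a, p a)) = 0" using a by (intro prod_zero) auto
      then show ?thesis by simp
    qed
    then show ?thesis by (subst det_def'[of _ i]) (auto intro!: dvd_sum)
  qed
qed

section \<open>Monic greatest common divisors\<close>

lemma poly_Gcd_eqI: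
  assumes "\<And>p. p \<in> P \<Longrightarrow> d dvd p" "\<And>q. (\<And>p. p \<in> P \<Longrightarrow> q dvd p) \<Longrightarrow> q dvd d" "lead_coeff d = 1"
  shows "poly_Gcd P = d"
  unfolding poly_Gcd_def
proof (rule the_equality)
  show "(\<forall>p\<in>P. d dvd p) \<and> (\<forall>q. (\<forall>p\<in>P. q dvd p) \<longrightarrow> q dvd d) \<and> (d = 0 \<or> lead_coeff d = 1)"
    using assms by blast
next
  fix e assume e: "(\<forall>p\<in>P. e dvd p) \<and> (\<forall>q. (\<forall>p\<in>P. q dvd p) \<longrightarrow> q dvd e) \<and> (e = 0 \<or> lead_coeff e = 1)"
  then have "e dvd d" "d dvd e" using assms by auto
  moreover from this have "lead_coeff e = 1" using e assms(3) by auto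
  ultimately show "e = d" using poly_dvd_antisym assms(3) by metis
qed

text \<open>Zero is sent to zero because \<open>inverse 0 = 0\<close>, so multiplicativity holds
  without side conditions.\<close>

definition monic_of :: "'a::field poly \<Rightarrow> 'a poly" where
  "monic_of p = Polynomial.smult (inverse (lead_coeff p)) p"

lemma monic_of_mult: "monic_of (p * q) = monic_of p * monic_of q"
  by (simp add: monic_of_def lead_coeff_mult mult.commute)

lemma monic_of_dvd_iff [simp]: "monic_of p dvd q \<longleftrightarrow> p dvd q"
  by (cases "p = 0") (auto simp: monic_of_def smult_dvd_iff)

lemma dvd_monic_of_iff [simp]: "q dvd monic_of p \<longleftrightarrow> q dvd p"
  by (cases "p = 0") (auto simp: monic_of_def dvd_smult_iff)

lemma lead_coeff_monic_of [simp]: "p \<noteq> 0 \<Longrightarrow> lead_coeff (monic_of p) = 1"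
  by (simp add: monic_of_def)

section \<open>Determinantal and elementary divisors read off from a Smith form\<close>

context
  fixes M S :: "'a::field poly mat" and n :: nat
  assumes equiv: "equiv_mat n M S" and det: "det M \<noteq> 0"
    and diag: "\<forall>i<n. \<forall>j<n. i \<noteq> j \<longrightarrow> S $$ (i,j) = 0"
    and chain: "\<forall>j<n. \<forall>i\<le>j. S $$ (i,i) dvd S $$ (j,j)"
begin

lemma dvd_minors_of_smith: "dvd_minors (\<Prod>k<i. S $$ (k,k)) n i M"
  using dvd_minors_equiv_mat[OF equiv_mat_sym[OF equiv] dvd_minors_smith[OF _ diag chain]]
    equiv_mat_carrier[OF equiv] by blast

text \<open>The full diagonal product divides \<open>det M\<close>, which is nonzero. This makes the
  later division by determinantal divisors legitimate.\<close>

lemma smith_diag_nonzero: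
  assumes "k < n"
  shows "S $$ (k,k) \<noteq> 0"
proof
  assume "S $$ (k,k) = 0"
  then have "(\<Prod>k<n. S $$ (k,k)) = 0" using assms by (intro prod_zero) auto
  moreover have "(\<Prod>k<n. S $$ (k,k)) dvd det (mat n n (\<lambda>(a,b). M $$ (a,b)))"
    using dvd_minorsD[OF dvd_minors_of_smith, of n "\<lambda>x. x" "\<lambda>x. x"] by simp
  moreover have "mat n n (\<lambda>(a,b). M $$ (a,b)) = M"
    using equiv_mat_carrier[OF equiv] by (intro eq_matI) auto
  ultimately show False using det dvd_0_left by metis
qed

text \<open>The product divides all minors of \<open>M\<close>. Conversely, a common divisor of
  these also divides all minors of \<open>S\<close>, in particular the leading principal one, which
  equals the product.\<close>

lemma det_divisor_smith:
  assumes "i \<le> n"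
  shows "det_divisor M i = monic_of (\<Prod>k<i. S $$ (k,k))"
proof (cases "i = 0")
  case True
  then show ?thesis by (simp add: det_divisor_def monic_of_def)
next
  case False
  note car = equiv_mat_carrier[OF equiv]
  let ?d = "\<Prod>k<i. S $$ (k,k)"
  have "poly_Gcd (minors M i) = monic_of ?d"
  proof (rule poly_Gcd_eqI)
    show "monic_of ?d dvd p" if "p \<in> minors M i" for p
      using dvd_minors_of_smith[of i] that by (simp add: dvd_minors_iff[OF car(1)])
    show "q dvd monic_of ?d" if "\<And>p. p \<in> minors M i \<Longrightarrow> q dvd p" for q
    proof -
      have "dvd_minors q n i S"
        using that by (intro dvd_minors_equiv_mat[OF equiv]) (simp add: dvd_minors_iff[OF car(1)])
      then have "q dvd det (mat i i (\<lambda>(a,b). S $$ (a,b)))"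
        using dvd_minorsD[of q n i S "\<lambda>x. x" "\<lambda>x. x"] assms by simp
      also have "det (mat i i (\<lambda>(a,b). S $$ (a,b))) = prod_list (diag_mat (mat i i (\<lambda>(a,b). S $$ (a,b))))"
        by (rule det_upper_triangular) (use diag assms in auto)
      also have "\<dots> = ?d" by (simp add: prod_list_diag_prod atLeast0LessThan)
      finally show ?thesis by simp
    qed
    have "?d \<noteq> 0" using smith_diag_nonzero assms by (auto simp: prod_zero_iff)
    then show "lead_coeff (monic_of ?d) = 1" by simp
  qed
  then show ?thesis using False by (simp add: det_divisor_def)
qed

text \<open>Consecutive diagonal products differ by one factor. Elementary divisors are counted from
  1 and diagonal positions from 0.\<close>

lemma elem_divisor_smith:
  assumes "s < n"
  shows "elem_divisor M (Suc s) = monic_of (S $$ (s,s))"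
proof -
  have "(\<Prod>k<s. S $$ (k,k)) \<noteq> 0" using smith_diag_nonzero assms by (auto simp: prod_zero_iff)
  then have "monic_of (\<Prod>k<s. S $$ (k,k)) \<noteq> 0" by (simp add: monic_of_def)
  then show ?thesis
    using assms by (simp add: elem_divisor_def det_divisor_smith monic_of_mult)
qed

end

section \<open>Invariant factors of a factored matrix\<close>

lemma index_mult_mat_sum:
  assumes "A \<in> carrier_mat m k" "B \<in> carrier_mat k l" "i < m" "j < l"
  shows "(A * B) $$ (i,j) = (\<Sum>x<k. A $$ (i,x) * B $$ (x,j))"
  using assms by (simp add: scalar_prod_def atLeast0LessThan)

text \<open>Padding with zero rows gives a square matrix of determinant zero. An integral domain
  suffices, so the lemma serves both polynomial and constant coefficients.\<close>

lemma homogeneous_system_nontrivial_solution: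
  fixes B :: "nat \<Rightarrow> nat \<Rightarrow> 'a::idom"
  assumes "k < N"
  shows "\<exists>v. (\<exists>j<N. v j \<noteq> 0) \<and> (\<forall>i<k. (\<Sum>j<N. B i j * v j) = 0)"
proof -
  let ?A = "mat N N (\<lambda>(i,j). if i < k then B i j else 0)"
  have "det ?A = (\<Sum>j<N. ?A $$ (k,j) * cofactor ?A k j)"
    by (rule laplace_expansion_row[of _ N]) (use assms in auto)
  also have "\<dots> = 0" using assms by (intro sum.neutral) auto
  finally obtain v where v: "v \<in> carrier_vec N" "v \<noteq> 0\<^sub>v N" "?A *\<^sub>v v = 0\<^sub>v N"
    using det_0_iff_vec_prod_zero[of ?A N] by auto
  show ?thesis
  proof (intro exI[of _ "\<lambda>j. v $ j"] conjI allI impI)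
    show "\<exists>j<N. v $ j \<noteq> 0"
    proof (rule ccontr)
      assume "\<not> ?thesis"
      then have "v = 0\<^sub>v N" using v(1) by (intro eq_vecI) auto
      with v(2) show False ..
    qed
    fix i assume i: "i < k"
    have "(?A *\<^sub>v v) $ i = (\<Sum>j<N. B i j * v $ j)"
      using i assms v(1) by (simp add: scalar_prod_def atLeast0LessThan)
    then show "(\<Sum>j<N. B i j * v $ j) = 0" using v(3) i assms by simp
  qed
qed

text \<open>A nonzero element of least degree in the ideal generated by the entries divides them
  all, by division with remainder. Dividing it out makes the row primitive.\<close>

lemma common_factor_bezout:
  fixes w :: "nat \<Rightarrow> 'a::field poly"
  assumes "\<exists>j<N. w j \<noteq> 0"
  obtains g u c where "g \<noteq> 0" "\<And>j. j < N \<Longrightarrow> w j = g * u j" "(\<Sum>j<N. c j * u j) = 1"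
proof -
  define I where "I = {\<Sum>j<N. c j * w j | c. True}"
  from assms obtain j where j: "j < N" "w j \<noteq> 0" by blast
  have wI: "w j \<in> I" if "j < N" for j
    unfolding I_def using that
    by (intro CollectI exI[of _ "\<lambda>k. if k = j then 1 else 0"]) (auto simp: if_distrib[of "\<lambda>x. x * _"] cong: if_cong)
  have diff: "p - q * p' \<in> I" if pp': "p \<in> I" "p' \<in> I" for p p' q
  proof -
    from pp' obtain c c' where "p = (\<Sum>j<N. c j * w j)" "p' = (\<Sum>j<N. c' j * w j)"
      unfolding I_def by blast
    then have "p - q * p' = (\<Sum>j<N. (c j - q * c' j) * w j)"
      by (simp add: sum_distrib_left sum_subtractf algebra_simps)
    then show ?thesis unfolding I_def by (intro CollectI exI conjI TrueI)
  qed
  from ex_has_least_nat[of "\<lambda>p. p \<in> I \<and> p \<noteq> 0" "w j" degree] wI[OF j(1)] j(2)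
  obtain g where g: "g \<in> I" "g \<noteq> 0" and min: "\<And>p. p \<in> I \<Longrightarrow> p \<noteq> 0 \<Longrightarrow> degree g \<le> degree p"
    by blast
  have dvd: "g dvd p" if p: "p \<in> I" for p
  proof (rule ccontr)
    assume "\<not> g dvd p"
    then have "p mod g \<noteq> 0" by (simp add: dvd_eq_mod_eq_0)
    moreover have "p mod g \<in> I"
      using diff[OF p g(1), of "p div g"] by (simp add: minus_div_mult_eq_mod)
    ultimately show False using min degree_mod_less[OF g(2), of p] by fastforce
  qed
  define u where "u = (\<lambda>j. w j div g)"
  have u: "w j = g * u j" if "j < N" for j using dvd[OF wI[OF that]] by (simp add: u_def)
  from g(1) obtain c where "g = (\<Sum>j<N. c j * w j)" unfolding I_def by blast
  also have "\<dots> = g * (\<Sum>j<N. c j * u j)"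
    unfolding sum_distrib_left by (rule sum.cong) (use u in \<open>auto simp: mult_ac\<close>)
  finally have "(\<Sum>j<N. c j * u j) = 1" using g(2) by simp
  then show ?thesis using that g(2) u by blast
qed

text \<open>After the common factor is cancelled, every summand is zero or a multiple of
  \<open>c\<close>, so \<open>c\<close> divides each \<open>f * u j\<close>. The Bezout relation for
  \<open>u\<close> then recovers \<open>f\<close>.\<close>

lemma dvd_of_row_relation:
  fixes w :: "nat \<Rightarrow> 'a::field poly"
  assumes nz: "\<exists>j<n. w j \<noteq> 0" and zero: "\<And>k. k < s \<Longrightarrow> w k = 0"
    and e: "\<And>k. s \<le> k \<Longrightarrow> k < n \<Longrightarrow> c dvd e k"
    and rel: "\<And>j. j < n \<Longrightarrow> f * w j = (\<Sum>k<n. w k * (e k * X k j))"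
  shows "c dvd f"
proof -
  from common_factor_bezout[OF nz] obtain g u d where
    g: "g \<noteq> 0" and u: "\<And>j. j < n \<Longrightarrow> w j = g * u j" and d: "(\<Sum>j<n. d j * u j) = 1" by blast
  have dvd: "c dvd f * u j" if j: "j < n" for j
  proof -
    have "g * (f * u j) = (\<Sum>k<n. g * u k * (e k * X k j))"
      using rel[OF j] u j by (simp add: mult_ac)
    also have "\<dots> = g * (\<Sum>k<n. u k * (e k * X k j))" by (simp add: sum_distrib_left mult_ac)
    finally have eq: "f * u j = (\<Sum>k<n. u k * (e k * X k j))" using g by simp
    have "c dvd u k * (e k * X k j)" if "k < n" for k
      using zero[of k] u[OF that] g e[OF _ that] by (cases "k < s") auto
    then show ?thesis unfolding eq by (intro dvd_sum) auto
  qed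
  have "f = (\<Sum>j<n. d j * (f * u j))"
    using d by (simp add: mult.left_commute[of _ f] flip: sum_distrib_left)
  also have "c dvd \<dots>" using dvd by (intro dvd_sum) auto
  finally show ?thesis .
qed

lemma smith_entry_dvd_of_factorization:
  fixes M :: "'a::field poly mat"
  assumes car: "P \<in> carrier_mat n r" "D \<in> carrier_mat r r" "Q \<in> carrier_mat r n"
    "L \<in> carrier_mat n r" "R \<in> carrier_mat r n" "F \<in> carrier_mat r r"
    and M: "M = P * D * Q" and LQ: "L * Q = 1\<^sub>m n" and PR: "P * R = 1\<^sub>m n" and DF: "D * F = f \<cdot>\<^sub>m 1\<^sub>m r"
    and equiv: "equiv_mat n M S"
    and diag: "\<forall>i<n. \<forall>j<n. i \<noteq> j \<longrightarrow> S $$ (i,j) = 0"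
    and chain: "\<forall>j<n. \<forall>i\<le>j. S $$ (i,i) dvd S $$ (j,j)"
    and s: "s < n" "s + r < 2 * n"
  shows "S $$ (s,s) dvd f"
proof -
  from equiv obtain U U' V V' where
    cM: "M \<in> carrier_mat n n" and cS: "S \<in> carrier_mat n n"
    and cU: "U \<in> carrier_mat n n" "U' \<in> carrier_mat n n"
    and cV: "V \<in> carrier_mat n n" "V' \<in> carrier_mat n n"
    and UU': "U * U' = 1\<^sub>m n" and "U' * U = 1\<^sub>m n" "V * V' = 1\<^sub>m n" "V' * V = 1\<^sub>m n" "S = U * M * V"
    and MS: "M = U' * S * V'"
    by (rule equiv_matE)
  define G where "G = U * P * D"
  have cG: "G \<in> carrier_mat n r" unfolding G_def using cU car by auto
  \<comment> \<open>The unknowns are the \<open>2 * n\<close> entries of two rows \<open>W\<close>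
    and \<open>Z\<close>. The first \<open>s\<close> equations annihilate the first \<open>s\<close>
    entries of \<open>W\<close>; the other \<open>r\<close> equations express
    \<open>W * G = Z * L\<close>.\<close>
  define B where "B = (\<lambda>i j. if i < s then if j = i then 1 else 0
    else if j < n then G $$ (j, i - s) else - L $$ (j - n, i - s))"
  from homogeneous_system_nontrivial_solution[OF s(2), of B]
  obtain v where v: "(\<exists>j<2*n. v j \<noteq> 0) \<and> (\<forall>i<s + r. (\<Sum>j<2*n. B i j * v j) = 0)"
    by (elim exE)
  from v have nz: "\<exists>j<2*n. v j \<noteq> 0" by (rule conjunct1)
  from v have sys: "\<forall>i<s + r. (\<Sum>j<2*n. B i j * v j) = 0" by (rule conjunct2)
  define W where "W = mat 1 n (\<lambda>(_,j). v j)"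
  define Z where "Z = mat 1 n (\<lambda>(_,j). v (n + j))"
  have cW: "W \<in> carrier_mat 1 n" and cZ: "Z \<in> carrier_mat 1 n" by (auto simp: W_def Z_def)
  have zero: "v i = 0" if "i < s" for i
    using sys[rule_format, of i] that s by (simp add: B_def if_distrib[of "\<lambda>x. x * _"] cong: if_cong)
  have "(\<Sum>j<m+k. g j) = (\<Sum>j<m. g j) + (\<Sum>j<k. g (m + j))" for m k and g :: "nat \<Rightarrow> 'a poly"
    by (induction k) (simp_all add: add.assoc)
  note split = this[of _ n n, folded mult_2]
  have WG: "W * G = Z * L"
  proof (rule eq_matI)
    fix i t assume "i < dim_row (Z * L)" "t < dim_col (Z * L)"
    then have it: "i = 0" "t < r" using cZ car by auto
    have "(\<Sum>j<n. G $$ (j,t) * v j) + (\<Sum>j<n. - L $$ (j,t) * v (n + j)) = 0"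
      using sys[rule_format, of "s + t"] it unfolding split by (simp add: B_def)
    then have "(\<Sum>j<n. v j * G $$ (j,t)) = (\<Sum>j<n. v (n + j) * L $$ (j,t))"
      by (simp add: sum_negf mult.commute)
    then show "(W * G) $$ (i,t) = (Z * L) $$ (i,t)"
      using it cG car by (simp add: W_def Z_def scalar_prod_def atLeast0LessThan)
  qed (use cW cZ cG car in auto)
  \<comment> \<open>Multiplying \<open>W * G = Z * L\<close> by \<open>Q\<close> on the right
    recovers \<open>Z\<close>, which is therefore determined by \<open>W\<close>; so
    \<open>W\<close> cannot vanish in a nontrivial solution.\<close>
  have Z: "Z = W * (U * M)"
  proof -
    have "Z = Z * (L * Q)" using LQ cZ by simp
    also have "\<dots> = (Z * L) * Q" using cZ car by (intro assoc_mult_mat[symmetric])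
    also have "\<dots> = W * (U * M)"
      unfolding WG[symmetric] M G_def using cW cU car
      by (simp add: assoc_mult_mat[of _ 1 n _ n _ n] assoc_mult_mat[of _ 1 n _ r _ n]
          assoc_mult_mat[of _ n n _ r _ n] assoc_mult_mat[of _ n n _ r _ r] assoc_mult_mat[of _ n r _ r _ n]
          assoc_mult_mat[of _ 1 n _ n _ r])
    finally show ?thesis .
  qed
  have Wnz: "\<exists>j<n. v j \<noteq> 0"
  proof (rule ccontr)
    assume W0: "\<not> ?thesis"
    then have "W = 0\<^sub>m 1 n" by (intro eq_matI) (auto simp: W_def)
    then have Z0: "Z = 0\<^sub>m 1 n" using Z cU cM by simp
    have "v (n + j) = 0" if "j < n" for j
    proof -
      have "v (n + j) = Z $$ (0,j)" using that by (simp add: Z_def)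
      then show ?thesis using that by (simp add: Z0)
    qed
    with W0 nz show False by (metis add_diff_inverse_nat mult_2 nat_add_left_cancel_less)
  qed
  \<comment> \<open>With this choice \<open>W * S * X\<close> becomes
    \<open>Z * L * F * R * U'\<close>. Replacing \<open>Z * L\<close> by \<open>W * G\<close>
    produces the factor \<open>D * F\<close>, and \<open>P * R\<close> and \<open>U * U'\<close>
    then collapse, leaving \<open>f\<close> times \<open>W\<close>.\<close>
  define X where "X = V' * (L * F * R * U')"
  have cX: "X \<in> carrier_mat n n" unfolding X_def using cU cV car by auto
  have UM: "U * M = S * V'"
  proof -
    have "U * M = (U * U') * (S * V')"
      unfolding MS using cU cS cV by (simp add: assoc_mult_mat[of _ n n _ n _ n])
    then show ?thesis using UU' cS cV by simp
  qed
  have cLF: "L * F * R * U' \<in> carrier_mat n n" using cU car by auto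
  have "W * (S * X) = Z * (L * F * R * U')"
    unfolding X_def Z UM using cW cS cV cLF
    by (simp add: assoc_mult_mat[of _ n n _ n _ n] assoc_mult_mat[of _ 1 n _ n _ n])
  also have "\<dots> = (Z * L) * (F * (R * U'))"
    using cZ car cU by (simp add: assoc_mult_mat[of _ 1 n _ r _ n] assoc_mult_mat[of _ n r _ r _ n]
       assoc_mult_mat[of _ n r _ n _ n] assoc_mult_mat[of _ r r _ n _ n] assoc_mult_mat[of _ r r _ r _ n])
  also have "\<dots> = W * (U * (P * ((D * F) * (R * U'))))"
    unfolding WG[symmetric] G_def using cW cU car
    by (simp add: assoc_mult_mat[of _ 1 n _ r _ n] assoc_mult_mat[of _ n n _ r _ n]
        assoc_mult_mat[of _ n r _ r _ n] assoc_mult_mat[of _ r r _ r _ n] assoc_mult_mat[of _ n n _ r _ r])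
  also have "(D * F) * (R * U') = f \<cdot>\<^sub>m (R * U')"
    unfolding DF using car cU by (subst mult_smult_assoc_mat[of _ r r _ n]) auto
  also have "P * (f \<cdot>\<^sub>m (R * U')) = f \<cdot>\<^sub>m ((P * R) * U')"
    using car cU by (simp add: mult_smult_distrib[of _ n r _ n] assoc_mult_mat[of _ n r _ n _ n])
  also have "U * \<dots> = f \<cdot>\<^sub>m 1\<^sub>m n"
    unfolding PR using cU UU' by (simp add: mult_smult_distrib[of _ n n _ n])
  also have "W * \<dots> = f \<cdot>\<^sub>m W" using cW by (simp add: mult_smult_distrib[of _ 1 n _ n])
  finally have rel: "f \<cdot>\<^sub>m W = W * (S * X)" ..
  have SX: "(S * X) $$ (k,j) = S $$ (k,k) * X $$ (k,j)" if "k < n" "j < n" for k j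
  proof -
    have "(S * X) $$ (k,j) = (\<Sum>l<n. S $$ (k,l) * X $$ (l,j))"
      by (rule index_mult_mat_sum[OF cS cX that])
    also have "\<dots> = (\<Sum>l<n. if l = k then S $$ (k,k) * X $$ (k,j) else 0)"
      by (rule sum.cong) (use that diag in auto)
    finally show ?thesis using that by simp
  qed
  show ?thesis
  proof (rule dvd_of_row_relation[OF Wnz zero, of s _ "\<lambda>k. S $$ (k,k)" _ "\<lambda>k j. X $$ (k,j)"])
    fix j assume j: "j < n"
    have "f * v j = (f \<cdot>\<^sub>m W) $$ (0,j)" using j by (simp add: W_def)
    also have "\<dots> = (\<Sum>k<n. W $$ (0,k) * (S * X) $$ (k,j))"
      unfolding rel by (rule index_mult_mat_sum[OF cW mult_carrier_mat[OF cS cX] _ j]) simp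
    also have "\<dots> = (\<Sum>k<n. v k * (S $$ (k,k) * X $$ (k,j)))"
      by (rule sum.cong) (use j SX in \<open>auto simp: W_def simp del: index_mult_mat(1)\<close>)
    finally show "f * v j = \<dots>" .
  qed (use chain in auto)
qed

text \<open>Induction on \<open>T\<close>: if \<open>b\<close> is a root of \<open>p\<close>, its
  linear factor is cancelled on both sides. Otherwise \<open>b\<close> is a root of the cofactor,
  and \<open>p\<close> already divides the product over \<open>T\<close>.\<close>

lemma splits_distinct_dvd_prod:
  fixes p :: "'a::field poly"
  assumes "finite T" "p dvd (\<Prod>a\<in>T. [:-a, 1:])" "lead_coeff p = 1"
  shows "splits_distinct p"
proof -
  have "\<exists>T'\<subseteq>T. p = (\<Prod>a\<in>T'. [:-a, 1:])"
    using assms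
  proof (induction T arbitrary: p rule: finite_induct)
    case empty
    then have "p dvd 1" by simp
    then have "p = 1" using empty.prems by (metis dvd_refl one_dvd poly_dvd_antisym lead_coeff_1)
    then show ?case by simp
  next
    case (insert b T)
    let ?g = "\<Prod>a\<in>T. [:-a, 1:]"
    have d: "p dvd [:-b,1:] * ?g" using insert by simp
    show ?case
    proof (cases "poly p b = 0")
      case True
      then obtain q where q: "p = [:-b,1:] * q" by (auto simp: poly_eq_0_iff_dvd elim: dvdE)
      then have "q dvd ?g" using d by (metis dvd_mult_cancel_left pCons_eq_0_iff zero_neq_one)
      moreover have "lead_coeff q = 1" using insert.prems(2) unfolding q lead_coeff_mult by simp
      ultimately obtain T' where T': "T' \<subseteq> T" "q = (\<Prod>a\<in>T'. [:-a, 1:])" using insert.IH by blast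
      have "p = (\<Prod>a\<in>insert b T'. [:-a, 1:])"
        unfolding q T'(2) by (rule prod.insert[symmetric]) (use T' insert.hyps finite_subset in auto)
      then show ?thesis using T'(1) by blast
    next
      case False
      obtain q where q: "[:-b,1:] * ?g = p * q" using d by (elim dvdE)
      have "poly ([:-b,1:] * ?g) b = 0" by simp
      then have "poly q b = 0" unfolding q using False by simp
      then obtain q' where "q = [:-b,1:] * q'" by (auto simp: poly_eq_0_iff_dvd elim: dvdE)
      then have "[:-b,1:] * ?g = [:-b,1:] * (p * q')" using q by (simp only: mult.left_commute)
      then have "?g = p * q'" by (metis mult_cancel_left pCons_eq_0_iff zero_neq_one)
      then have "p dvd ?g" by simp
      with insert.IH insert.prems(2) show ?thesis by blast
    qed
  qed
  then show ?thesis unfolding splits_distinct_def using assms(1) finite_subset by blast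
qed

section \<open>Rank-one decompositions\<close>

text \<open>The body repeats the condition under \<open>LEAST\<close> in
  \<open>tensor_rank2\<close>, so that it can be folded there.\<close>

definition rank_one_decomposition ::
  "nat \<Rightarrow> 'a::field mat \<Rightarrow> 'a mat \<Rightarrow> nat \<Rightarrow> (nat \<Rightarrow> 'a vec) \<Rightarrow> (nat \<Rightarrow> 'a vec) \<Rightarrow>
    (nat \<Rightarrow> 'a) \<Rightarrow> (nat \<Rightarrow> 'a) \<Rightarrow> bool" where
  "rank_one_decomposition n B C r a b \<alpha> \<beta> \<longleftrightarrow>
      (\<forall>j<r. a j \<in> carrier_vec n \<and> b j \<in> carrier_vec n \<and> a j \<noteq> 0\<^sub>v n \<and> b j \<noteq> 0\<^sub>v n
              \<and> (\<alpha> j, \<beta> j) \<noteq> (0, 0)) \<and>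
      (\<forall>p<n. \<forall>q<n. B $$ (p, q) = (\<Sum>j<r. \<alpha> j * (a j $ p) * (b j $ q))
                 \<and> C $$ (p, q) = (\<Sum>j<r. \<beta> j * (a j $ p) * (b j $ q)))"

text \<open>Each position contributes a product of unit vectors; positions where both slices vanish
  are left out, since the coefficient pair must be nonzero. Hence the least length is
  attained.\<close>

lemma rank_one_decomposition_exists:
  fixes B C :: "'a::field mat"
  shows "\<exists>r a b \<alpha> \<beta>. rank_one_decomposition n B C r a b \<alpha> \<beta>"
proof -
  let ?J = "{x \<in> {..<n} \<times> {..<n}. (B $$ x, C $$ x) \<noteq> (0, 0)}"
  have fin: "finite ?J" by simp
  from ex_bij_betw_nat_finite[OF this] obtain h where h: "bij_betw h {..<card ?J} ?J"
    by (auto simp: atLeast0LessThan)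
  have hJ: "h j \<in> ?J" if "j < card ?J" for j using bij_betwE[OF h] that by blast
  have sum: "(\<Sum>j<card ?J. X $$ (h j) * (unit_vec n (fst (h j)) $ p) * (unit_vec n (snd (h j)) $ q)) = X $$ (p,q)"
    if X: "X = B \<or> X = C" and pq: "p < n" "q < n" for X p q
  proof -
    have "(\<Sum>j<card ?J. X $$ (h j) * (unit_vec n (fst (h j)) $ p) * (unit_vec n (snd (h j)) $ q)) =
        (\<Sum>x\<in>?J. X $$ x * (unit_vec n (fst x) $ p) * (unit_vec n (snd x) $ q))"
      by (rule sum.reindex_bij_betw[OF h])
    also have "\<dots> = (\<Sum>x\<in>{..<n} \<times> {..<n}. X $$ x * (unit_vec n (fst x) $ p) * (unit_vec n (snd x) $ q))"
      by (rule sum.mono_neutral_left) (use X in auto)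
    also have "\<dots> = (\<Sum>x\<in>{..<n} \<times> {..<n}. if x = (p,q) then X $$ (p,q) else 0)"
      by (rule sum.cong) (use pq in \<open>auto simp: unit_vec_def\<close>)
    also have "\<dots> = X $$ (p,q)" using pq by simp
    finally show ?thesis .
  qed
  have "rank_one_decomposition n B C (card ?J) (\<lambda>j. unit_vec n (fst (h j))) (\<lambda>j. unit_vec n (snd (h j)))
      (\<lambda>j. B $$ (h j)) (\<lambda>j. C $$ (h j))"
    unfolding rank_one_decomposition_def
  proof (intro conjI allI impI)
    fix j assume "j < card ?J"
    from hJ[OF this] have lt: "fst (h j) < n" "snd (h j) < n" and nz: "(B $$ (h j), C $$ (h j)) \<noteq> (0,0)"
      by (auto simp: mem_Times_iff)
    show "unit_vec n (fst (h j)) \<noteq> 0\<^sub>v n" "unit_vec n (snd (h j)) \<noteq> 0\<^sub>v n"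
      using unit_vec_nonzero[OF lt(1)] unit_vec_nonzero[OF lt(2)] by auto
    show "(B $$ (h j), C $$ (h j)) \<noteq> (0,0)" by (rule nz)
  next
    fix p q assume "p < n" "q < n"
    then show "B $$ (p, q) = (\<Sum>j<card ?J. B $$ (h j) * (unit_vec n (fst (h j)) $ p) * (unit_vec n (snd (h j)) $ q))"
      "C $$ (p, q) = (\<Sum>j<card ?J. C $$ (h j) * (unit_vec n (fst (h j)) $ p) * (unit_vec n (snd (h j)) $ q))"
      by (simp_all only: sum[of B p q] sum[of C p q] simp_thms)
  qed simp_all
  then show ?thesis by blast
qed

text \<open>With fewer than \<open>n\<close> terms, some nonzero \<open>v\<close> would be
  orthogonal to every \<open>\<alpha> t * a t\<close>, and multiplying the identity slice by
  \<open>v\<close> from the left would give zero.\<close>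

lemma rank_one_decomposition_length_ge:
  fixes C :: "'a::field mat"
  assumes "rank_one_decomposition n (1\<^sub>m n) C r a b \<alpha> \<beta>"
  shows "n \<le> r"
proof (rule ccontr)
  assume "\<not> ?thesis"
  then have "r < n" by simp
  from homogeneous_system_nontrivial_solution[OF this, of "\<lambda>t p. \<alpha> t * a t $ p"]
  obtain v q where q: "q < n" "v q \<noteq> 0" and v: "\<And>t. t < r \<Longrightarrow> (\<Sum>p<n. \<alpha> t * a t $ p * v p) = 0"
    by blast
  have "v q = (\<Sum>p<n. if p = q then v p else 0)" using q by simp
  also have "\<dots> = (\<Sum>p<n. v p * (\<Sum>t<r. \<alpha> t * a t $ p * b t $ q))"
  proof (rule sum.cong[OF refl])
    fix p assume "p \<in> {..<n}"
    then have "(\<Sum>t<r. \<alpha> t * a t $ p * b t $ q) = (1\<^sub>m n :: 'a mat) $$ (p,q)"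
      using assms q unfolding rank_one_decomposition_def by auto
    then show "(if p = q then v p else 0) = v p * (\<Sum>t<r. \<alpha> t * a t $ p * b t $ q)"
      using q \<open>p \<in> _\<close> by simp
  qed
  also have "\<dots> = (\<Sum>t<r. \<Sum>p<n. v p * (\<alpha> t * a t $ p * b t $ q))"
    unfolding sum_distrib_left by (rule sum.swap)
  also have "\<dots> = (\<Sum>t<r. b t $ q * (\<Sum>p<n. \<alpha> t * a t $ p * v p))"
    by (simp add: sum_distrib_left mult_ac)
  also have "\<dots> = 0" using v by simp
  finally show False using q by simp
qed

section \<open>Factoring the characteristic matrix through a diagonal matrix\<close>

lemma sum_linear_poly: "(\<Sum>j\<in>J. [:x j, y j:]) = [:\<Sum>j\<in>J. x j, \<Sum>j\<in>J. y j:]"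
  by (induction J rule: infinite_finite_induct) auto

lemma sum_const_poly: "(\<Sum>j\<in>J. [:x j:]) = [:\<Sum>j\<in>J. x j:]"
  by (induction J rule: infinite_finite_induct) auto

lemma invariant_poly_splits_distinct:
  fixes A :: "'a::field mat"
  assumes A: "A \<in> carrier_mat n n" and dec: "rank_one_decomposition n (1\<^sub>m n) A r a b \<alpha> \<beta>"
    and i: "1 \<le> i" "i \<le> n" "r < n + i"
  shows "splits_distinct (invariant_poly A i)"
proof -
  let ?M = "char_poly_matrix A"
  define d where "d = (\<lambda>j. [:- \<beta> j, \<alpha> j:])"
  \<comment> \<open>Being a set, \<open>T\<close> counts repeated roots once, which makes
    \<open>f\<close> squarefree. Terms with \<open>\<alpha> j = 0\<close> have a nonzero constant
    \<open>d j\<close>, a unit.\<close>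
  define T where "T = (\<lambda>j. \<beta> j / \<alpha> j) ` {j. j < r \<and> \<alpha> j \<noteq> 0}"
  define f where "f = (\<Prod>c\<in>T. [:-c, 1:])"
  have finT: "finite T" by (simp add: T_def)
  have df: "d j dvd f" if j: "j < r" for j
  proof (cases "\<alpha> j = 0")
    case True
    then have "\<beta> j \<noteq> 0" using dec j unfolding rank_one_decomposition_def by auto
    then have "d j dvd 1" using True by (simp add: d_def is_unit_pCons_iff)
    then show ?thesis by (rule dvd_trans) simp
  next
    case False
    then have "d j = Polynomial.smult (\<alpha> j) [:- (\<beta> j / \<alpha> j), 1:]" by (simp add: d_def)
    then have "d j dvd [:- (\<beta> j / \<alpha> j), 1:]" using False by (metis dvd_refl smult_dvd)
    also have "[:- (\<beta> j / \<alpha> j), 1:] dvd f"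
      unfolding f_def using finT False j by (intro dvd_prodI) (auto simp: T_def)
    finally show ?thesis .
  qed
  define P where "P = mat n r (\<lambda>(p,j). [:a j $ p:])"
  define Q where "Q = mat r n (\<lambda>(j,q). [:b j $ q:])"
  \<comment> \<open>The weights \<open>\<alpha> j\<close> are put into \<open>L\<close> and
    \<open>R\<close>, so that \<open>L * Q\<close> and \<open>P * R\<close> both express the
    decomposition of the identity slice.\<close>
  define L where "L = mat n r (\<lambda>(p,j). [:\<alpha> j * a j $ p:])"
  define R where "R = mat r n (\<lambda>(j,q). [:\<alpha> j * b j $ q:])"
  define D where "D = mat r r (\<lambda>(j,k). if j = k then d j else 0)"
  define F where "F = mat r r (\<lambda>(j,k). if j = k then f div d j else 0)"
  note defs = P_def Q_def L_def R_def D_def F_def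
  have car: "P \<in> carrier_mat n r" "D \<in> carrier_mat r r" "Q \<in> carrier_mat r n"
    "L \<in> carrier_mat n r" "R \<in> carrier_mat r n" "F \<in> carrier_mat r r"
    by (simp_all add: defs)
  have E: "(\<Sum>j<r. \<alpha> j * a j $ p * b j $ q) = (if p = q then 1 else 0)"
    and C: "(\<Sum>j<r. \<beta> j * a j $ p * b j $ q) = A $$ (p,q)" if "p < n" "q < n" for p q
    using dec that unfolding rank_one_decomposition_def by (auto split: if_splits)
  have E1: "(\<Sum>j<r. [:\<alpha> j * a j $ p * b j $ q:]) = 1\<^sub>m n $$ (p,q)" if "p < n" "q < n" for p q
    using that by (simp add: sum_const_poly E)
  have LQ: "L * Q = 1\<^sub>m n"
  proof (rule eq_matI)
    fix p q assume "p < dim_row (1\<^sub>m n :: 'a poly mat)" "q < dim_col (1\<^sub>m n :: 'a poly mat)"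
    then have pq: "p < n" "q < n" by auto
    then have "(L * Q) $$ (p,q) = (\<Sum>j<r. [:\<alpha> j * a j $ p * b j $ q:])"
      by (simp add: L_def Q_def scalar_prod_def atLeast0LessThan mult_ac)
    then show "(L * Q) $$ (p,q) = 1\<^sub>m n $$ (p,q)" unfolding E1[OF pq] .
  qed (simp_all add: L_def Q_def)
  have PR: "P * R = 1\<^sub>m n"
  proof (rule eq_matI)
    fix p q assume "p < dim_row (1\<^sub>m n :: 'a poly mat)" "q < dim_col (1\<^sub>m n :: 'a poly mat)"
    then have pq: "p < n" "q < n" by auto
    then have "(P * R) $$ (p,q) = (\<Sum>j<r. [:\<alpha> j * a j $ p * b j $ q:])"
      by (simp add: P_def R_def scalar_prod_def atLeast0LessThan mult_ac)
    then show "(P * R) $$ (p,q) = 1\<^sub>m n $$ (p,q)" unfolding E1[OF pq] .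
  qed (simp_all add: P_def R_def)
  have DF: "D * F = f \<cdot>\<^sub>m 1\<^sub>m r"
  proof (rule eq_matI)
    fix j k assume "j < dim_row (f \<cdot>\<^sub>m 1\<^sub>m r)" "k < dim_col (f \<cdot>\<^sub>m 1\<^sub>m r)"
    then have jk: "j < r" "k < r" by auto
    have "(D * F) $$ (j,k) = (\<Sum>l<r. (if j = l then d j else 0) * (if l = k then f div d l else 0))"
      using jk by (simp add: D_def F_def scalar_prod_def atLeast0LessThan)
    also have "\<dots> = (\<Sum>l<r. if l = j then (if j = k then f else 0) else 0)"
      by (rule sum.cong) (use jk df in auto)
    finally show "(D * F) $$ (j,k) = (f \<cdot>\<^sub>m 1\<^sub>m r) $$ (j,k)" using jk by simp
  qed (simp_all add: D_def F_def)
  have M: "?M = P * D * Q"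
  proof (rule eq_matI)
    fix p q assume "p < dim_row (P * D * Q)" "q < dim_col (P * D * Q)"
    then have pq: "p < n" "q < n" by (auto simp: P_def Q_def)
    have PD: "(P * D) $$ (p,j) = [:a j $ p:] * d j" if j: "j < r" for j
    proof -
      have "(P * D) $$ (p,j) = (\<Sum>l<r. [:a l $ p:] * (if l = j then d l else 0))"
        using pq j by (simp add: P_def D_def scalar_prod_def atLeast0LessThan)
      also have "\<dots> = (\<Sum>l<r. if l = j then [:a j $ p:] * d j else 0)"
        by (rule sum.cong) auto
      finally show ?thesis using j by simp
    qed
    have "(P * D * Q) $$ (p,q) = (\<Sum>j<r. (P * D) $$ (p,j) * Q $$ (j,q))"
      by (rule index_mult_mat_sum[OF mult_carrier_mat[OF car(1,2)] car(3) pq])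
    also have "\<dots> = (\<Sum>j<r. [:- (\<beta> j * a j $ p * b j $ q), \<alpha> j * a j $ p * b j $ q:])"
      by (rule sum.cong) (use pq PD in \<open>auto simp: Q_def d_def mult_ac\<close>)
    also have "\<dots> = [:- A $$ (p,q), if p = q then 1 else 0:]"
      using pq by (simp add: sum_linear_poly sum_negf C E)
    finally show "?M $$ (p,q) = (P * D * Q) $$ (p,q)"
      using pq A by (simp add: char_poly_matrix_def)
  qed (use A in \<open>auto simp: P_def Q_def char_poly_matrix_def\<close>)
  have cM: "?M \<in> carrier_mat n n" using A by simp
  have "det ?M \<noteq> 0" using degree_monic_char_poly[OF A] unfolding char_poly_def by auto
  moreover obtain S where S: "equiv_mat n ?M S" "\<forall>i<n. \<forall>j<n. i \<noteq> j \<longrightarrow> S $$ (i,j) = 0"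
    "\<forall>j<n. \<forall>i\<le>j. S $$ (i,i) dvd S $$ (j,j)"
    using smith_form_exists[OF cM] by blast
  \<comment> \<open>The \<open>i\<close>-th invariant polynomial is the elementary divisor number
    \<open>n - i + 1\<close>, located at diagonal position \<open>n - i\<close>.\<close>
  ultimately have inv: "invariant_poly A i = monic_of (S $$ (n - i, n - i))"
    and nz: "S $$ (n - i, n - i) \<noteq> 0"
    using elem_divisor_smith[of n ?M S "n - i"] smith_diag_nonzero[of n ?M S "n - i"] i A
    by (auto simp: invariant_poly_def)
  \<comment> \<open>For \<open>s = n - i\<close> the condition \<open>s + r < 2 * n\<close> is
    exactly \<open>r < n + i\<close>.\<close>
  have "S $$ (n - i, n - i) dvd f"
    by (rule smith_entry_dvd_of_factorization[OF car M LQ PR DF S]) (use i in auto)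
  then show ?thesis
    unfolding inv using nz splits_distinct_dvd_prod[OF finT] by (simp add: f_def)
qed

theorem mainTheorem11:
  fixes A :: "'a::field mat" and n :: nat
  assumes "A \<in> carrier_mat n n"
  shows "n + card {i \<in> {1..n}. \<not> splits_distinct (invariant_poly A i)}
           \<le> tensor_rank2 n (1\<^sub>m n) A"
proof -
  let ?r = "tensor_rank2 n (1\<^sub>m n) A"
  have "\<exists>a b \<alpha> \<beta>. rank_one_decomposition n (1\<^sub>m n) A ?r a b \<alpha> \<beta>"
    unfolding tensor_rank2_def rank_one_decomposition_def[symmetric]
    by (rule LeastI_ex) (rule rank_one_decomposition_exists)
  then obtain a b \<alpha> \<beta> where dec: "rank_one_decomposition n (1\<^sub>m n) A ?r a b \<alpha> \<beta>" by blast
  \<comment> \<open>An index that fails to split must violate \<open>r < n + i\<close>. The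
    truncated difference is harmless because the rank is at least \<open>n\<close>.\<close>
  have "{i \<in> {1..n}. \<not> splits_distinct (invariant_poly A i)} \<subseteq> {1..?r - n}"
    using invariant_poly_splits_distinct[OF assms dec] by force
  from card_mono[OF _ this] show ?thesis using rank_one_decomposition_length_ge[OF dec] by simp
qed

end
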